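(* There exist constants $c,\gamma>0$ such that for every integer $n\ge 2$ there are points $p_1,\ldots,p_n\in[0,1]^2$ and lines $\ell_1,\ldots,\ell_n\subset\mathbb{R}^2$ such that $p_i\in\ell_i$ for every $i$, and $d(p_i,\ell_j)\ge c\,n^{\gamma-1}$ for all $i\neq j$.
   Context: $d(p,\ell)$ denotes the Euclidean distance from the point $p$ to the line $\ell$. *)

theory Defs
  imports "HOL-Analysis.Analysis"
begin

definition is_line :: "'a::euclidean_space set \<Rightarrow> bool" where
  "is_line L \<longleftrightarrow> affine L \<and> aff_dim L = 1"

end

theory Submission imports Defs begin

text \<open>
  Encode a point with a line through it as a triple \<open>(x, a, y)\<close>: the point \<open>(x, y)\<close> and the
  slope \<open>a\<close>. The vertical distance from the point of one triple to the line of another is an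
  integer when the triples are integral, so it suffices that it never vanishes. Modulo 3 the four
  triples \<open>(x, a, -ax)\<close> with \<open>x, a \<in> {-1, 1}\<close> (a conic in the plane over the field
  of 3 elements with its tangents) form such a configuration. As \<open>4 > 3\<close>, putting these triples
  in as the lowest ternary digits of \<open>x\<close>, \<open>a\<close> and \<open>y\<close>, together with a free second digit of
  \<open>y\<close>, multiplies the number of triples by \<open>4 \<cdot> 3 = 12\<close>, while the box containing
  them grows by \<open>3\<close> in \<open>x\<close> and in \<open>a\<close>, and by \<open>9\<close> in \<open>y\<close>. Rescaling to the unit square
  after \<open>k\<close> steps gives \<open>12^k\<close> pairs at mutual distance of order \<open>9^-k\<close>.
\<close>

fun offset :: "int \<times> int \<times> int \<Rightarrow> int \<times> int \<times> int \<Rightarrow> int" where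
  "offset (x, a, y) (x', a', y') = y - y' - a' * (x - x')"

lemma offset_self [simp]: "offset z z = 0"
  by (cases z) auto

text \<open>The term \<open>3 * c * x\<close> straightens the lines of slope \<open>c\<close>, so that for equal low digits
  \<open>b, c\<close> only the offset of the smaller triples remains.\<close>

fun extend :: "(int \<times> int \<times> int) \<times> int \<times> int \<times> int \<Rightarrow> int \<times> int \<times> int" where
  "extend ((x, a, y), b, c, u) = (b + 3 * x, c + 3 * a, 3 * c * x - b * c + 3 * u + 9 * y)"

text \<open>If the low digits \<open>b, c\<close> agree, then either \<open>z = z'\<close> and
  \<open>u, u'\<close> differ, or \<open>3 * (u - u')\<close>, of size at most 6, cannot cancel a
  nonzero multiple of 9. If they differ, the offset is nonzero modulo 3.\<close>

lemma offset_extend_ne_0: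
  assumes b: "b \<in> {-1, 1}" "b' \<in> {-1, 1}" and c: "c \<in> {-1, 1}" "c' \<in> {-1, 1}"
    and u: "u \<in> {-1, 0, 1}" "u' \<in> {-1, 0, 1}"
    and ne: "(z, b, c, u) \<noteq> (z', b', c', u')" and z: "z \<noteq> z' \<Longrightarrow> offset z z' \<noteq> 0"
  shows "offset (extend (z, b, c, u)) (extend (z', b', c', u')) \<noteq> 0"
proof -
  obtain x a y x' a' y' where zz: "z = (x, a, y)" "z' = (x', a', y')"
    by (metis prod_cases3)
  show ?thesis
  proof (cases "b = b' \<and> c = c'")
    case True
    have "offset (extend (z, b, c, u)) (extend (z', b', c', u')) = 3 * (u - u') + 9 * offset z z'"
      using True by (simp add: zz algebra_simps)
    moreover have "3 * (u - u') + 9 * offset z z' \<noteq> 0"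
    proof (cases "z = z'")
      case True
      then show ?thesis using ne \<open>b = b' \<and> c = c'\<close> by simp
    next
      case False
      moreover have "\<bar>u - u'\<bar> \<le> 2" using u by auto
      ultimately show ?thesis using z by presburger
    qed
    ultimately show ?thesis by simp
  next
    case False
    \<comment> \<open>This is the offset of the low-digit triples \<open>(b, c, - b * c)\<close> and
      \<open>(b', c', - b' * c')\<close>.\<close>
    define r where "r = b' * c' - b * c - c' * (b - b')"
    obtain m where "offset (extend (z, b, c, u)) (extend (z', b', c', u')) = r + 3 * m"
    proof
      show "offset (extend (z, b, c, u)) (extend (z', b', c', u')) =
        r + 3 * (c * x - c' * x' + u - u' + 3 * (y - y') - c' * (x - x') - a' * (b - b' + 3 * (x - x')))"
        by (simp add: zz r_def algebra_simps)
    qed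
    \<comment> \<open>If \<open>c\<close> and \<open>c'\<close> differ, \<open>r\<close> is 2 or -2;
      otherwise it is 4 or -4. None of these is divisible by 3.\<close>
    moreover have "\<bar>r\<bar> \<in> {1, 2, 4}"
      using b c False by (auto simp: r_def)
    ultimately show ?thesis by auto presburger+
  qed
qed

text \<open>Apply \<open>extend\<close> k times, starting from one triple. The bounds on
  \<open>x\<close> and \<open>a\<close> are those for k balanced ternary digits. Subtracting
  \<open>3 ^ k\<close> in the bound on \<open>y\<close> leaves room for the lower-order terms that
  \<open>extend\<close> adds.\<close>

lemma integer_configuration:
  "\<exists>S. finite S \<and> card S = 12 ^ k \<and>
     (\<forall>(x, a, y)\<in>S. 2 * \<bar>x\<bar> \<le> 3 ^ k - 1 \<and> 2 * \<bar>a\<bar> \<le> 3 ^ k - 1 \<and> \<bar>y\<bar> \<le> 9 ^ k - 3 ^ k) \<and>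
     (\<forall>z\<in>S. \<forall>z'\<in>S. z \<noteq> z' \<longrightarrow> offset z z' \<noteq> 0)"
proof (induction k)
  case 0
  show ?case by (rule exI[of _ "{(0, 0, 0)}"]) auto
next
  case (Suc k)
  then obtain S where S: "finite S" "card S = 12 ^ k"
    and bnd: "\<And>x a y. (x, a, y) \<in> S \<Longrightarrow>
      2 * \<bar>x\<bar> \<le> 3 ^ k - 1 \<and> 2 * \<bar>a\<bar> \<le> 3 ^ k - 1 \<and> \<bar>y\<bar> \<le> 9 ^ k - 3 ^ k"
    and off: "\<And>z z'. z \<in> S \<Longrightarrow> z' \<in> S \<Longrightarrow> z \<noteq> z' \<Longrightarrow> offset z z' \<noteq> 0"
    by fast
  define D where "D = S \<times> {-1, 1::int} \<times> {-1, 1::int} \<times> {-1, 0, 1::int}"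
  have off': "offset (extend d) (extend d') \<noteq> 0" if "d \<in> D" "d' \<in> D" "d \<noteq> d'" for d d'
  proof -
    obtain z b c u z' b' c' u' where d: "d = (z, b, c, u)" "d' = (z', b', c', u')"
      by (metis prod_cases4)
    have "z \<in> S" "b \<in> {-1, 1}" "c \<in> {-1, 1}" "u \<in> {-1, 0, 1}"
      "z' \<in> S" "b' \<in> {-1, 1}" "c' \<in> {-1, 1}" "u' \<in> {-1, 0, 1}"
      using that(1,2) unfolding d D_def mem_Sigma_iff by blast+
    then show ?thesis
      using that(3) off unfolding d by (intro offset_extend_ne_0)
  qed
  \<comment> \<open>Equal images would have offset 0.\<close>
  then have inj: "inj_on extend D"
    by (metis inj_onI offset_self)
  show ?case
  proof (intro exI[of _ "extend ` D"] conjI)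
    show "finite (extend ` D)"
      using S by (simp add: D_def)
    show "card (extend ` D) = 12 ^ Suc k"
      using S by (simp add: card_image[OF inj]) (simp add: D_def card_cartesian_product)
    show "\<forall>z\<in>extend ` D. \<forall>z'\<in>extend ` D. z \<noteq> z' \<longrightarrow> offset z z' \<noteq> 0"
    proof (intro ballI impI)
      fix z z' assume "z \<in> extend ` D" "z' \<in> extend ` D" "z \<noteq> z'"
      then obtain d d' where "d \<in> D" "d' \<in> D" "z = extend d" "z' = extend d'" "d \<noteq> d'"
        by blast
      then show "offset z z' \<noteq> 0"
        using off' by simp
    qed
    have "2 * \<bar>b + 3 * x\<bar> \<le> 3 ^ Suc k - 1 \<and> 2 * \<bar>c + 3 * a\<bar> \<le> 3 ^ Suc k - 1 \<and>
        \<bar>3 * c * x - b * c + 3 * u + 9 * y\<bar> \<le> 9 ^ Suc k - 3 ^ Suc k"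
      if "(x, a, y) \<in> S" "b \<in> {-1, 1}" "c \<in> {-1, 1}" "u \<in> {-1, 0, 1}" for x a y b c u
    proof -
      have digits: "\<bar>b\<bar> = 1" "\<bar>c\<bar> = 1" "\<bar>c * x\<bar> = \<bar>x\<bar>" "\<bar>b * c\<bar> = 1" "\<bar>u\<bar> \<le> 1"
        using that(2-) by auto
      define t s :: int where "t = 3 ^ k" and "s = 9 ^ k"
      have t: "1 \<le> t" and x: "2 * \<bar>x\<bar> \<le> t - 1" and a: "2 * \<bar>a\<bar> \<le> t - 1" and y: "\<bar>y\<bar> \<le> s - t"
        using bnd[OF that(1)] by (auto simp: t_def s_def)
      have "2 * \<bar>b + 3 * x\<bar> \<le> 3 * t - 1"
        using digits(1) x by (smt (verit))
      moreover have "2 * \<bar>c + 3 * a\<bar> \<le> 3 * t - 1"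
        using digits(2) a by (smt (verit))
      moreover have "\<bar>3 * (c * x) - b * c + 3 * u + 9 * y\<bar> \<le> 3 * \<bar>x\<bar> + 4 + 9 * \<bar>y\<bar>"
        using digits(3-) by (smt (verit))
      \<comment> \<open>Since \<open>t \<ge> 1\<close>,
        \<open>9 * (s - t) + 3 * (t - 1) / 2 + 4 \<le> 9 * s - 3 * t\<close>.\<close>
      then have "\<bar>3 * (c * x) - b * c + 3 * u + 9 * y\<bar> \<le> 9 * s - 3 * t"
        using x y t by (smt (verit))
      ultimately show ?thesis
        unfolding t_def s_def power_Suc mult.assoc by blast
    qed
    then show "\<forall>(x, a, y)\<in>extend ` D. 2 * \<bar>x\<bar> \<le> 3 ^ Suc k - 1 \<and> 2 * \<bar>a\<bar> \<le> 3 ^ Suc k - 1 \<and>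
        \<bar>y\<bar> \<le> 9 ^ Suc k - 3 ^ Suc k"
      by (auto simp only: D_def extend.simps mem_Sigma_iff del: insertE)
  qed
qed

lemma is_line_hyperplane:
  fixes w :: "real^2"
  assumes "w \<noteq> 0"
  shows "is_line {q. w \<bullet> q = b}"
  using assms by (simp add: is_line_def affine_hyperplane)

text \<open>Cauchy-Schwarz for \<open>w\<close> and \<open>p - q\<close>, with \<open>q\<close> on
  the hyperplane.\<close>

lemma infdist_hyperplane_ge:
  fixes w :: "'a::euclidean_space"
  assumes "w \<noteq> 0"
  shows "\<bar>w \<bullet> p - b\<bar> / norm w \<le> infdist p {q. w \<bullet> q = b}"
proof -
  have ne: "{q. w \<bullet> q = b} \<noteq> {}"
    using assms by (auto intro: exI[of _ "(b / (w \<bullet> w)) *\<^sub>R w"])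
  have "\<bar>w \<bullet> p - b\<bar> / norm w \<le> dist p q" if "w \<bullet> q = b" for q
    using Cauchy_Schwarz_ineq2[of w "p - q"] assms that
    by (simp add: dist_norm inner_diff_right divide_simps mult.commute)
  then show ?thesis
    using ne by (auto simp: infdist_notempty intro!: cINF_greatest)
qed

lemma separated_point_line_pairs:
  assumes "n \<le> 12 ^ k"
  shows "\<exists>(p :: nat \<Rightarrow> real^2) l.
    (\<forall>i\<in>{1..n}. p i \<in> cbox 0 1 \<and> is_line (l i) \<and> p i \<in> l i) \<and>
    (\<forall>i\<in>{1..n}. \<forall>j\<in>{1..n}. i \<noteq> j \<longrightarrow> infdist (p i) (l j) \<ge> 1 / (4 * 9 ^ k))"
proof -
  obtain S where S: "finite S" "card S = 12 ^ k"
    and bnd: "\<And>x a y. (x, a, y) \<in> S \<Longrightarrow>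
      2 * \<bar>x\<bar> \<le> 3 ^ k - 1 \<and> 2 * \<bar>a\<bar> \<le> 3 ^ k - 1 \<and> \<bar>y\<bar> \<le> 9 ^ k - 3 ^ k"
    and off: "\<And>z z'. z \<in> S \<Longrightarrow> z' \<in> S \<Longrightarrow> z \<noteq> z' \<Longrightarrow> offset z z' \<noteq> 0"
    using integer_configuration[of k] by fast
  obtain f where f: "f ` {1..n} \<subseteq> S" "inj_on f {1..n}"
    using card_le_inj[of "{1..n}" S] S assms by auto
  \<comment> \<open>Dividing \<open>x\<close> by \<open>3 ^ k\<close> and \<open>y\<close> by
    \<open>2 * 9 ^ k\<close> turns slope \<open>a\<close> into \<open>a / (2 * 3 ^ k)\<close>;
    \<open>W\<close> is a normal vector for that slope.\<close>
  define P :: "int \<times> int \<times> int \<Rightarrow> real^2" where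
    "P = (\<lambda>(x, a, y). vector [1/2 + x / 3 ^ k, 1/2 + y / (2 * 9 ^ k)])"
  define W :: "int \<times> int \<times> int \<Rightarrow> real^2" where
    "W = (\<lambda>(x, a, y). vector [- (a / (2 * 3 ^ k)), 1])"
  have P: "P z \<in> cbox 0 1" if "z \<in> S" for z
  proof -
    obtain x a y where z: "z = (x, a, y)" by (metis prod_cases3)
    have "2 * \<bar>x\<bar> \<le> 3 ^ k" "\<bar>y\<bar> \<le> 9 ^ k"
      using bnd[of x a y] that z zero_less_power[of "3::int" k] by auto
    then have "real_of_int (2 * \<bar>x\<bar>) \<le> real_of_int (3 ^ k)" "real_of_int \<bar>y\<bar> \<le> real_of_int (9 ^ k)"
      by (simp_all only: of_int_le_iff)
    then have "\<bar>x / 3 ^ k\<bar> \<le> 1/2" "\<bar>y / (2 * 9 ^ k)\<bar> \<le> 1/2"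
      by (simp_all add: divide_simps)
    then show ?thesis
      unfolding z P_def prod.case mem_box_cart forall_2 vector_2 zero_index one_index by linarith
  qed
  have W_ne: "W z \<noteq> 0" for z
    by (cases z) (simp add: W_def vec_eq_iff forall_2)
  have W_norm: "norm (W z) \<le> 2" if "z \<in> S" for z
  proof -
    obtain x a y where z: "z = (x, a, y)" by (metis prod_cases3)
    have "\<bar>a\<bar> \<le> 3 ^ k"
      using bnd[of x a y] that z by auto
    then have "real_of_int \<bar>a\<bar> \<le> real_of_int (3 ^ k)"
      by (simp only: of_int_le_iff)
    then have "\<bar>a / (2 * 3 ^ k)\<bar> \<le> 1"
      by (simp add: divide_simps)
    moreover have "norm (W z) \<le> \<bar>a / (2 * 3 ^ k)\<bar> + 1"
      using norm_le_l1_cart[of "W z"] by (simp add: z W_def sum_2)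
    ultimately show ?thesis
      by linarith
  qed
  have WP: "W z' \<bullet> P z - W z' \<bullet> P z' = offset z z' / (2 * 9 ^ k)" for z z'
  proof -
    have "(9::real) ^ k = 3 ^ k * 3 ^ k"
      by (simp flip: power_mult_distrib)
    then show ?thesis
      by (cases z; cases z') (simp add: W_def P_def inner_vec_def sum_2 field_simps)
  qed
  define l where "l z = {q. W z \<bullet> q = W z \<bullet> P z}" for z
  \<comment> \<open>A nonzero integer offset contributes at least \<open>1 / (2 * 9 ^ k)\<close>;
    the normal of length at most 2 costs another factor 2.\<close>
  have dist: "infdist (P z) (l z') \<ge> 1 / (4 * 9 ^ k)" if "z \<in> S" "z' \<in> S" "z \<noteq> z'" for z z'
  proof -
    have "1 \<le> \<bar>real_of_int (offset z z')\<bar>"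
      using off[OF that] by linarith
    then have "1 / (4 * 9 ^ k) \<le> \<bar>W z' \<bullet> P z - W z' \<bullet> P z'\<bar> / 2"
      by (simp add: WP divide_simps)
    also have "\<dots> \<le> \<bar>W z' \<bullet> P z - W z' \<bullet> P z'\<bar> / norm (W z')"
      using W_norm[OF that(2)] W_ne by (intro divide_left_mono) auto
    also have "\<dots> \<le> infdist (P z) (l z')"
      unfolding l_def by (intro infdist_hyperplane_ge W_ne)
    finally show ?thesis .
  qed
  show ?thesis
  proof (intro exI[of _ "P \<circ> f"] exI[of _ "l \<circ> f"] conjI ballI impI)
    fix i assume "i \<in> {1..n}"
    with f show "(P \<circ> f) i \<in> cbox 0 1"
      by (simp add: P image_subset_iff)
    show "is_line ((l \<circ> f) i)"
      by (simp add: l_def is_line_hyperplane W_ne)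
    show "(P \<circ> f) i \<in> (l \<circ> f) i"
      by (simp add: l_def)
  next
    fix i j assume "i \<in> {1..n}" "j \<in> {1..n}" "i \<noteq> j"
    with f show "1 / (4 * 9 ^ k) \<le> infdist ((P \<circ> f) i) ((l \<circ> f) j)"
      by (auto intro!: dist dest: inj_onD)
  qed
qed

theorem theorem1p1:
  "\<exists>c \<gamma> :: real. c > 0 \<and> \<gamma> > 0 \<and>
     (\<forall>n::nat. n \<ge> 2 \<longrightarrow>
       (\<exists>(p :: nat \<Rightarrow> real^2) (l :: nat \<Rightarrow> (real^2) set).
          (\<forall>i\<in>{1..n}. p i \<in> cbox 0 1 \<and> is_line (l i) \<and> p i \<in> l i) \<and>
          (\<forall>i\<in>{1..n}. \<forall>j\<in>{1..n}. i \<noteq> j \<longrightarrow>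
             infdist (p i) (l j) \<ge> c * real n powr (\<gamma> - 1))))"
proof -
  \<comment> \<open>With this exponent \<open>9 ^ k = (12 ^ k) powr \<alpha>\<close>, and \<alpha> <
    1 because 9 < 12, so \<gamma> = 1 - \<alpha> is positive.\<close>
  define \<alpha> :: real where "\<alpha> = log 12 9"
  have \<alpha>: "\<alpha> > 0" "\<alpha> < 1" "12 powr \<alpha> = 9"
    by (simp_all add: \<alpha>_def)
  have "\<exists>(p :: nat \<Rightarrow> real^2) l.
      (\<forall>i\<in>{1..n}. p i \<in> cbox 0 1 \<and> is_line (l i) \<and> p i \<in> l i) \<and>
      (\<forall>i\<in>{1..n}. \<forall>j\<in>{1..n}. i \<noteq> j \<longrightarrow> infdist (p i) (l j) \<ge> 1/36 * real n powr (- \<alpha>))"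
    if "n \<ge> 2" for n :: nat
  proof -
    have "1 \<le> n"
      using that by simp
    \<comment> \<open>Taking n of the \<open>12 ^ (k + 1)\<close> pairs costs one more factor 9,
      whence 1/36 = 1/(4 * 9).\<close>
    then obtain k where k: "12 ^ k \<le> n" "n < 12 ^ (k + 1)"
      using ex_power_ivl1[of 12 n] by auto
    have "(9::real) ^ k = (12 powr \<alpha>) ^ k"
      using \<alpha>(3) by simp
    also have "\<dots> = (12 ^ k) powr \<alpha>"
      by (simp add: powr_powr mult.commute flip: powr_realpow)
    also have "\<dots> \<le> real n powr \<alpha>"
    proof (rule powr_mono2)
      show "12 ^ k \<le> real n"
        using k(1) by (metis of_nat_le_iff of_nat_numeral of_nat_power)
    qed (use \<alpha>(1) in auto)
    finally have le: "1/36 * real n powr (- \<alpha>) \<le> 1 / (4 * 9 ^ (k + 1))"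
      using that by (simp add: powr_minus divide_simps)
    have "n \<le> 12 ^ (k + 1)"
      using k(2) by simp
    then obtain p :: "nat \<Rightarrow> real^2" and l
      where "\<forall>i\<in>{1..n}. p i \<in> cbox 0 1 \<and> is_line (l i) \<and> p i \<in> l i"
        and "\<forall>i\<in>{1..n}. \<forall>j\<in>{1..n}. i \<noteq> j \<longrightarrow> infdist (p i) (l j) \<ge> 1 / (4 * 9 ^ (k + 1))"
      using separated_point_line_pairs by blast
    then show ?thesis
      using order_trans[OF le] by (intro exI[of _ p] exI[of _ l]) blast
  qed
  then show ?thesis
    using \<alpha> by (intro exI[of _ "1/36"] exI[of _ "1 - \<alpha>"]) auto
qed

end
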